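(* Let $\mathbb F$ be a field of characteristic $p>3$ and let $\mathcal H$ be the Heisenberg Lie algebra with basis $x,y,z$ and bracket $[x,y]=z$, $z$ central. Then $\dim_{\mathbb F}H^2_*(\mathcal H,0)=8$ and $\dim_{\mathbb F}H^2_*(\mathcal H,x^* )=\dim_{\mathbb F}H^2_*(\mathcal H,z^* )=4$. Moreover (writing only the nonzero values on the basis): (1) a basis of $H^2_*(\mathcal H,0)$ is given by the classes of $(\varphi_1,0),(\varphi_2,0),(\varphi_3,0),(\varphi_4,0),(\varphi_5,0),(0,\omega_1),(0,\omega_2),(0,\omega_3)$, with $\varphi_1(x,z)=z$; $\varphi_2(y,z)=z$; $\varphi_3(x,z)=x,\ \varphi_3(y,z)=-y$; $\varphi_4(x,z)=y$; $\varphi_5(y,z)=x$; $\omega_1(x)=z$; $\omega_2(y)=z$; $\omega_3(z)=z$; (2) a basis of $H^2_*(\mathcal H,x^* )$ is given by the classes of $(\varphi_1,0),(\varphi_2,0),(0,\omega_1),(0,\omega_2)$, with $\varphi_1(x,y)=x$; $\varphi_2(x,y)=y$; $\omega_1(y)=z$; $\omega_2(z)=z$; (3) a basis of $H^2_*(\mathcal H,z^* )$ is given by the classes of $(\varphi_1,0),(\varphi_2,0),(0,\omega_1),(0,\omega_2)$, with $\varphi_1(x,y)=x$; $\varphi_2(x,y)=y$; $\omega_1(y)=z$; $\omega_2(x)=z$.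
   Context: For a linear form $\theta:\mathcal H\to\mathbb F$, $(\mathcal H,\theta)$ is the restricted Lie algebra $\mathcal H$ with $p$-map $(\alpha x+\beta y+\gamma z)^{[p]}=(\alpha^p\theta(x)+\beta^p\theta(y)+\gamma^p\theta(z))z$. $x^*,y^*,z^*$ is the dual basis. $H^2_*(\mathcal H,\theta)$ denotes the second restricted (Evans–Fuchs) cohomology $H^2_*(L,L)$ of $L=(\mathcal H,\theta)$ with adjoint coefficients, defined as follows for a restricted Lie algebra $L$ in characteristic $p\ge3$. Notation: $[x_1,\dots,x_n]:=[[\cdots[x_1,x_2],x_3],\cdots,x_n]$; $u\cdot m=[u,m]$. $C^n_{CE}(L,L)$ is the space of alternating $n$-linear maps, $d^1_{CE}\psi(u,v)=-\psi([u,v])+[u,\psi(v)]-[v,\psi(u)]$, $d^2_{CE}\varphi(u,v,w)=-\varphi([u,v],w)+\varphi([u,w],v)-\varphi([v,w],u)+[u,\varphi(v,w)]-[v,\varphi(u,w)]+[w,\varphi(u,v)]$. $C^2_*(L,L)$ is the vector space of pairs $(\varphi,\omega)$ with $\varphi\in C^2_{CE}(L,L)$ and $\omega:L\to L$ satisfying $\omega(\lambda u)=\lambda^p\omega(u)$ and $$\omega(u+v)=\omega(u)+\omega(v)+\sum_{\substack{x_i\in\{u,v\}\\ x_1=u,\ x_2=v}}\frac1{\sharp\{u\}}\sum_{k=0}^{p-2}(-1)^k\,x_p\cdot x_{p-1}\cdots x_{p-k+1}\cdot\varphi([x_1,\dots,x_{p-k-1}],x_{p-k}),$$ the outer sum being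 over $p$-tuples of symbols in $\{u,v\}$ with $x_1=u,x_2=v$, and $\sharp\{u\}$ the number of $x_i$ equal to $u$. (For $L=\mathcal H$ and $p>3$ the last sum vanishes, so $\omega$ is simply $p$-semilinear, i.e. additive with $\omega(\lambda u)=\lambda^p\omega(u)$, hence determined by its values on $x,y,z$.) $Z^2_*(L,L)$ consists of $(\varphi,\omega)\in C^2_*(L,L)$ with $d^2_{CE}\varphi=0$ and $\mathrm{ind}^2(\varphi,\omega)=0$, where $\mathrm{ind}^2(\varphi,\omega)(u,v)=-\varphi(u,v^{[p]})+\sum_{i+j=p-1}(-1)^i\mathrm{ad}_v^i\big(\varphi([u,\underbrace{v,\dots,v}_j],v)\big)-[u,\omega(v)]$. $B^2_*(L,L)$ consists of the pairs $(d^1_{CE}\psi,\mathrm{ind}^1\psi)$, $\psi\in\mathrm{Hom}_{\mathbb F}(L,L)$, with $\mathrm{ind}^1\psi(u)=-\psi(u^{[p]})+\mathrm{ad}_u^{p-1}(\psi(u))$. $H^2_*(L,L)=Z^2_*(L,L)/B^2_*(L,L)$. *)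

theory Defs
  imports
    "HOL-Analysis.Cartesian_Space"
    "HOL-Library.Function_Algebras"
    "Jordan_Normal_Form.VS_Connect"
begin

no_notation Matrix.vec_index (infixl \<open>$\<close> 100)

section \<open>Quotient vector spaces\<close>

definition coset_of :: "'v::ab_group_add set \<Rightarrow> 'v \<Rightarrow> 'v set" where
  "coset_of B v = {v + b | b. b \<in> B}"

text \<open>
  The quotient \<open>Z / B\<close> of subspaces \<open>B \<subseteq> Z\<close> of a vector space with scalar multiplication \<open>s\<close>,
  as a record of HOL-Algebra, so that \<^const>\<open>vectorspace.dim\<close> and \<^const>\<open>vectorspace.basis\<close>
  apply. The multiplicative part of the record plays no role for a module.
  In \<open>smult\<close>, adding \<open>B\<close> only matters for the scalar \<open>0\<close>.
\<close>

definition quotient_space ::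
    "('f \<Rightarrow> 'v \<Rightarrow> 'v::ab_group_add) \<Rightarrow> 'v set \<Rightarrow> 'v set \<Rightarrow> ('f, 'v set) module" where
  "quotient_space s Z B =
    \<lparr>carrier = coset_of B ` Z, mult = undefined, one = undefined, zero = B,
     add = (\<lambda>X Y. {u + v | u v. u \<in> X \<and> v \<in> Y}),
     smult = (\<lambda>c X. {s c u + b | u b. u \<in> X \<and> b \<in> B})\<rparr>"


section \<open>Restricted Lie algebras and their second cohomology with adjoint coefficients\<close>

text \<open>The left-normed bracket \<open>[x\<^sub>1, \<dots>, x\<^sub>n] = [[\<dots>[x\<^sub>1, x\<^sub>2], \<dots>], x\<^sub>n]\<close>.\<close>

definition left_normed :: "('v \<Rightarrow> 'v \<Rightarrow> 'v) \<Rightarrow> 'v list \<Rightarrow> 'v" where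
  "left_normed br xs = foldl br (hd xs) (tl xs)"

text \<open>
  The index set of the sums over \<open>x\<^sub>i \<in> {u, v}\<close> with \<open>x\<^sub>1 = u\<close>, \<open>x\<^sub>2 = v\<close>: the \<open>x\<^sub>i\<close> are formal symbols
  (\<open>u = v\<close> is allowed), so a tuple is encoded by a Boolean list with \<open>True\<close> for \<open>u\<close> and
  \<open>False\<close> for \<open>v\<close>. The weight \<open>1 / #{u}\<close> is then
  \<open>inverse (of_nat (count_list w True))\<close>.
\<close>

definition uv_words :: "nat \<Rightarrow> bool list set" where
  "uv_words n = {w. length w = n \<and> w ! 0 \<and> \<not> w ! 1}"

definition subst_uv :: "'v \<Rightarrow> 'v \<Rightarrow> bool list \<Rightarrow> 'v list" where
  "subst_uv u v w = map (\<lambda>b. if b then u else v) w"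

locale restricted_lie_algebra = vector_space scale
  for scale :: "'f::field \<Rightarrow> 'v::ab_group_add \<Rightarrow> 'v" (infixr \<open>*s\<close> 75) +
  fixes br :: "'v \<Rightarrow> 'v \<Rightarrow> 'v"
    and pmap :: "'v \<Rightarrow> 'v"
  assumes char_ge_3: "3 \<le> CHAR('f)"
    and br_linear_left: "Vector_Spaces.linear (*s) (*s) (\<lambda>u. br u v)"
    and br_linear_right: "Vector_Spaces.linear (*s) (*s) (br u)"
    and br_alternating: "br u u = 0"
    and br_jacobi: "br (br u v) w + br (br v w) u + br (br w u) v = 0"
    and br_pmap: "br (pmap u) v = (br u ^^ CHAR('f)) v"
    and pmap_scale: "pmap (c *s u) = (c ^ CHAR('f)) *s pmap u"
    and pmap_add: "pmap (u + v) = pmap u + pmap v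
      + (\<Sum>w\<in>uv_words CHAR('f).
          inverse (of_nat (count_list w True)) *s left_normed br (subst_uv u v w))"
begin

definition CE2 :: "('v \<Rightarrow> 'v \<Rightarrow> 'v) set" where
  "CE2 = {\<phi>. (\<forall>u. Vector_Spaces.linear (*s) (*s) (\<phi> u))
            \<and> (\<forall>v. Vector_Spaces.linear (*s) (*s) (\<lambda>u. \<phi> u v))
            \<and> (\<forall>u. \<phi> u u = 0)}"

definition d1 :: "('v \<Rightarrow> 'v) \<Rightarrow> 'v \<Rightarrow> 'v \<Rightarrow> 'v" where
  "d1 \<psi> u v = - \<psi> (br u v) + br u (\<psi> v) - br v (\<psi> u)"

definition d2 :: "('v \<Rightarrow> 'v \<Rightarrow> 'v) \<Rightarrow> 'v \<Rightarrow> 'v \<Rightarrow> 'v \<Rightarrow> 'v" where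
  "d2 \<phi> u v w = - \<phi> (br u v) w + \<phi> (br u w) v - \<phi> (br v w) u
                + br u (\<phi> v w) - br v (\<phi> u w) + br w (\<phi> u v)"

text \<open>
  The inner sum \<open>\<Sum>\<^sub>k (-1)\<^sup>k x\<^sub>p \<cdot> x\<^sub>p\<^sub>-\<^sub>1 \<cdots> x\<^sub>p\<^sub>-\<^sub>k\<^sub>+\<^sub>1 \<cdot> \<phi>([x\<^sub>1, \<dots>, x\<^sub>p\<^sub>-\<^sub>k\<^sub>-\<^sub>1], x\<^sub>p\<^sub>-\<^sub>k)\<close> for the \<open>p\<close>-tuple
  \<open>xs\<close>. Lists are indexed from \<open>0\<close>, so \<open>x\<^sub>p\<^sub>-\<^sub>k\<close> is \<open>xs ! (p - k - 1)\<close>, and \<open>fold br\<close> applies the last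
  \<open>k\<close> entries with \<open>x\<^sub>p\<^sub>-\<^sub>k\<^sub>+\<^sub>1\<close> innermost and \<open>x\<^sub>p\<close> outermost.
\<close>

definition star_sum :: "('v \<Rightarrow> 'v \<Rightarrow> 'v) \<Rightarrow> 'v list \<Rightarrow> 'v" where
  "star_sum \<phi> xs = (let p = CHAR('f) in
     \<Sum>k = 0..p - 2. ((-1) ^ k) *s
       fold br (drop (p - k) xs) (\<phi> (left_normed br (take (p - k - 1) xs)) (xs ! (p - k - 1))))"

definition C2 :: "(('v \<Rightarrow> 'v \<Rightarrow> 'v) \<times> ('v \<Rightarrow> 'v)) set" where
  "C2 = {(\<phi>, \<omega>). \<phi> \<in> CE2
          \<and> (\<forall>c u. \<omega> (c *s u) = (c ^ CHAR('f)) *s \<omega> u)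
          \<and> (\<forall>u v. \<omega> (u + v) = \<omega> u + \<omega> v
                + (\<Sum>w\<in>uv_words CHAR('f).
                    inverse (of_nat (count_list w True)) *s star_sum \<phi> (subst_uv u v w)))}"

definition ind1 :: "('v \<Rightarrow> 'v) \<Rightarrow> 'v \<Rightarrow> 'v" where
  "ind1 \<psi> u = - \<psi> (pmap u) + (br u ^^ (CHAR('f) - 1)) (\<psi> u)"

definition ind2 :: "('v \<Rightarrow> 'v \<Rightarrow> 'v) \<Rightarrow> ('v \<Rightarrow> 'v) \<Rightarrow> 'v \<Rightarrow> 'v \<Rightarrow> 'v" where
  "ind2 \<phi> \<omega> u v = - \<phi> u (pmap v)
     + (\<Sum>(i, j) \<in> {(i, j). i + j = CHAR('f) - 1}.
          ((-1) ^ i) *s (br v ^^ i) (\<phi> (left_normed br (u # replicate j v)) v))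
     - br u (\<omega> v)"

definition Z2 :: "(('v \<Rightarrow> 'v \<Rightarrow> 'v) \<times> ('v \<Rightarrow> 'v)) set" where
  "Z2 = {(\<phi>, \<omega>) \<in> C2. (\<forall>u v w. d2 \<phi> u v w = 0) \<and> (\<forall>u v. ind2 \<phi> \<omega> u v = 0)}"

definition B2 :: "(('v \<Rightarrow> 'v \<Rightarrow> 'v) \<times> ('v \<Rightarrow> 'v)) set" where
  "B2 = {(d1 \<psi>, ind1 \<psi>) | \<psi>. Vector_Spaces.linear (*s) (*s) \<psi>}"

definition cochain_scale ::
    "'f \<Rightarrow> ('v \<Rightarrow> 'v \<Rightarrow> 'v) \<times> ('v \<Rightarrow> 'v) \<Rightarrow> ('v \<Rightarrow> 'v \<Rightarrow> 'v) \<times> ('v \<Rightarrow> 'v)" where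
  "cochain_scale c = (\<lambda>(\<phi>, \<omega>). (\<lambda>u v. c *s \<phi> u v, \<lambda>u. c *s \<omega> u))"

definition H2 :: "('f, (('v \<Rightarrow> 'v \<Rightarrow> 'v) \<times> ('v \<Rightarrow> 'v)) set) module" where
  "H2 = quotient_space cochain_scale Z2 B2"

definition H2_class :: "('v \<Rightarrow> 'v \<Rightarrow> 'v) \<Rightarrow> ('v \<Rightarrow> 'v) \<Rightarrow> (('v \<Rightarrow> 'v \<Rightarrow> 'v) \<times> ('v \<Rightarrow> 'v)) set" where
  "H2_class \<phi> \<omega> = coset_of B2 (\<phi>, \<omega>)"

end


section \<open>The Heisenberg algebra\<close>

abbreviation hx :: "'a::field ^ 3" where "hx \<equiv> axis 1 1"
abbreviation hy :: "'a::field ^ 3" where "hy \<equiv> axis 2 1"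
abbreviation hz :: "'a::field ^ 3" where "hz \<equiv> axis 3 1"

definition heis_br :: "'a::field ^ 3 \<Rightarrow> 'a ^ 3 \<Rightarrow> 'a ^ 3" where
  "heis_br u v = (u $ 1 * v $ 2 - u $ 2 * v $ 1) *s hz"

definition heis_pmap :: "('a::field ^ 3 \<Rightarrow> 'a) \<Rightarrow> 'a ^ 3 \<Rightarrow> 'a ^ 3" where
  "heis_pmap \<theta> u =
     (u $ 1 ^ CHAR('a) * \<theta> hx + u $ 2 ^ CHAR('a) * \<theta> hy + u $ 3 ^ CHAR('a) * \<theta> hz) *s hz"

lemma left_normed_heis_br:
  assumes "3 \<le> length xs"
  shows "left_normed heis_br xs = 0"
proof -
  obtain a b c ys where xs: "xs = a # b # c # ys"
    using assms by (metis Suc_le_length_iff numeral_3_eq_3)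
  have "foldl heis_br 0 ys = 0"
    by (induction ys) (auto simp: heis_br_def)
  moreover have "heis_br (heis_br a b) c = 0"
    by (simp add: heis_br_def axis_def)
  ultimately show ?thesis
    by (simp add: left_normed_def xs)
qed

lemma restricted_lie_algebra_heis:
  fixes \<theta> :: "'a::field ^ 3 \<Rightarrow> 'a"
  assumes p: "3 < CHAR('a)"
  shows "restricted_lie_algebra (*s) heis_br (heis_pmap \<theta>)"
proof (intro restricted_lie_algebra.intro restricted_lie_algebra_axioms.intro)
  show "vector_space ((*s) :: 'a \<Rightarrow> 'a ^ 3 \<Rightarrow> 'a ^ 3)"
    by unfold_locales
  have prime: "prime CHAR('a)"
    using p by (intro prime_CHAR_semidom) auto
  have nilp: "heis_br u (heis_br v w) = 0" for u v w :: "'a ^ 3"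
    by (simp add: heis_br_def axis_def)
  show "3 \<le> CHAR('a)"
    using p by simp
  fix u v w :: "'a ^ 3" and c d :: 'a
  show "Vector_Spaces.linear (*s) (*s) (\<lambda>u. heis_br u v)"
    by unfold_locales (auto simp: heis_br_def vec_eq_iff algebra_simps)
  show "Vector_Spaces.linear (*s) (*s) (heis_br u)"
    by unfold_locales (auto simp: heis_br_def vec_eq_iff algebra_simps)
  show "heis_br u u = 0"
    by (simp add: heis_br_def)
  show "heis_br (heis_br u v) w + heis_br (heis_br v w) u + heis_br (heis_br w u) v = 0"
    by (simp add: heis_br_def axis_def)
  obtain n where "CHAR('a) = Suc (Suc n)"
    using p by (auto dest: less_imp_Suc_add simp: numeral_3_eq_3)
  hence "(heis_br u ^^ CHAR('a)) v = 0"
    by (simp add: nilp)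
  moreover have "heis_br (heis_pmap \<theta> u) v = 0"
    by (simp add: heis_br_def heis_pmap_def axis_def)
  ultimately show "heis_br (heis_pmap \<theta> u) v = (heis_br u ^^ CHAR('a)) v"
    by simp
  show "heis_pmap \<theta> (c *s u) = (c ^ CHAR('a)) *s heis_pmap \<theta> u"
    by (simp add: heis_pmap_def power_mult_distrib algebra_simps vec_eq_iff)
  have "left_normed heis_br (subst_uv u v ws) = 0" if "ws \<in> uv_words CHAR('a)" for ws
    using that p by (intro left_normed_heis_br) (auto simp: uv_words_def subst_uv_def)
  hence "(\<Sum>ws\<in>uv_words CHAR('a). inverse (of_nat (count_list ws True)) *s
            left_normed heis_br (subst_uv u v ws)) = 0"
    by (intro sum.neutral) auto
  moreover have "heis_pmap \<theta> (u + v) = heis_pmap \<theta> u + heis_pmap \<theta> v"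
    by (simp add: heis_pmap_def freshmans_dream[OF prime] algebra_simps vec_eq_iff)
  ultimately show "heis_pmap \<theta> (u + v) = heis_pmap \<theta> u + heis_pmap \<theta> v
      + (\<Sum>ws\<in>uv_words CHAR('a). inverse (of_nat (count_list ws True)) *s
            left_normed heis_br (subst_uv u v ws))"
    by simp
qed

definition x_dual :: "'a::field ^ 3 \<Rightarrow> 'a" where "x_dual u = u $ 1"
definition z_dual :: "'a::field ^ 3 \<Rightarrow> 'a" where "z_dual u = u $ 3"

definition heis_H2 ::
    "('a::field ^ 3 \<Rightarrow> 'a) \<Rightarrow> ('a, (('a ^ 3 \<Rightarrow> 'a ^ 3 \<Rightarrow> 'a ^ 3) \<times> ('a ^ 3 \<Rightarrow> 'a ^ 3)) set) module" where
  "heis_H2 \<theta> = restricted_lie_algebra.H2 (*s) heis_br (heis_pmap \<theta>)"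

definition heis_class ::
    "('a::field ^ 3 \<Rightarrow> 'a) \<Rightarrow> ('a ^ 3 \<Rightarrow> 'a ^ 3 \<Rightarrow> 'a ^ 3) \<Rightarrow> ('a ^ 3 \<Rightarrow> 'a ^ 3)
      \<Rightarrow> (('a ^ 3 \<Rightarrow> 'a ^ 3 \<Rightarrow> 'a ^ 3) \<times> ('a ^ 3 \<Rightarrow> 'a ^ 3)) set" where
  "heis_class \<theta> \<phi> \<omega> = restricted_lie_algebra.H2_class (*s) heis_br (heis_pmap \<theta>) \<phi> \<omega>"

text \<open>
  \<open>heis_alt a b c\<close> is the alternating bilinear map with values \<open>a\<close>, \<open>b\<close>, \<open>c\<close> on \<open>(x, y)\<close>, \<open>(x, z)\<close>,
  \<open>(y, z)\<close>, and \<open>heis_semilin a b c\<close> the \<open>p\<close>-semilinear map with values \<open>a\<close>, \<open>b\<close>, \<open>c\<close> on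
  \<open>x\<close>, \<open>y\<close>, \<open>z\<close>.
\<close>

definition heis_alt :: "'a::field ^ 3 \<Rightarrow> 'a ^ 3 \<Rightarrow> 'a ^ 3 \<Rightarrow> 'a ^ 3 \<Rightarrow> 'a ^ 3 \<Rightarrow> 'a ^ 3" where
  "heis_alt a b c u v =
     (u $ 1 * v $ 2 - u $ 2 * v $ 1) *s a
   + (u $ 1 * v $ 3 - u $ 3 * v $ 1) *s b
   + (u $ 2 * v $ 3 - u $ 3 * v $ 2) *s c"

definition heis_semilin :: "'a::field ^ 3 \<Rightarrow> 'a ^ 3 \<Rightarrow> 'a ^ 3 \<Rightarrow> 'a ^ 3 \<Rightarrow> 'a ^ 3" where
  "heis_semilin a b c u =
     (u $ 1 ^ CHAR('a)) *s a + (u $ 2 ^ CHAR('a)) *s b + (u $ 3 ^ CHAR('a)) *s c"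

lemma heis_alt_basis:
  "heis_alt a b c hx hy = a" "heis_alt a b c hx hz = b" "heis_alt a b c hy hz = c"
  by (simp_all add: heis_alt_def axis_def)

lemma heis_semilin_basis:
  assumes "0 < CHAR('a::field)"
  shows "heis_semilin a b c (hx :: 'a ^ 3) = a"
    and "heis_semilin a b c (hy :: 'a ^ 3) = b"
    and "heis_semilin a b c (hz :: 'a ^ 3) = c"
  using assms by (simp_all add: heis_semilin_def axis_def zero_power)

end

theory Submission
  imports Defs
begin

text \<open>
  On \<open>\<H>\<close> all left-normed brackets of length at least 3 vanish and \<open>p \<ge> 5\<close>, so the correction sum in the
  definition of \<open>C\<^sup>2\<close> disappears, \<open>ind\<^sup>2(\<phi>, \<omega>)(u, v) = -\<phi>(u, v\<^bsup>[p]\<^esup>) - [u, \<omega>(v)]\<close> and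
  \<open>ind\<^sup>1\<psi>(u) = -\<psi>(u\<^bsup>[p]\<^esup>)\<close>. A cochain is thus given by the six vectors \<open>a, b, c\<close> (values of \<open>\<phi>\<close> on
  \<open>(x, y), (x, z), (y, z)\<close>) and \<open>d, e, f\<close> (values of \<open>\<omega>\<close> on \<open>x, y, z\<close>). Cocycles are cut out by the
  linear equations \<open>c\<^sub>2 + b\<^sub>1 = 0\<close>, \<open>\<theta>(x) b = -d\<^sub>2 z\<close>, \<open>\<theta>(x) c = d\<^sub>1 z\<close> and their analogues for \<open>y, z\<close>, and
  coboundaries depend only on \<open>s = \<psi>(z)\<close> and \<open>t = \<psi>(x)\<^sub>1 + \<psi>(y)\<^sub>2\<close>.
\<close>

section \<open>Bases of quotient spaces\<close>

context vector_space
begin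

lemma coset_of_eq_iff:
  assumes B: "subspace B"
  shows "coset_of B u = coset_of B v \<longleftrightarrow> u - v \<in> B"
proof
  assume "coset_of B u = coset_of B v"
  moreover have "u \<in> coset_of B u"
    using subspace_0[OF B] by (force simp: coset_of_def)
  ultimately show "u - v \<in> B"
    by (auto simp: coset_of_def)
next
  assume uv: "u - v \<in> B"
  have "\<exists>b'\<in>B. u + b = v + b'" if "b \<in> B" for b
    using subspace_add[OF B uv that] by (intro bexI[of _ "u - v + b"]) auto
  moreover have "\<exists>b'\<in>B. v + b = u + b'" if "b \<in> B" for b
    using subspace_diff[OF B that uv] by (intro bexI[of _ "b - (u - v)"]) auto
  ultimately show "coset_of B u = coset_of B v"
    by (auto simp: coset_of_def)
qed

lemma coset_of_zero: "coset_of B 0 = B"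
  by (simp add: coset_of_def)

lemma mem_coset_of: "x \<in> coset_of B u \<longleftrightarrow> (\<exists>b\<in>B. x = u + b)"
  by (auto simp: coset_of_def)

lemma quotient_space_add:
  assumes B: "subspace B"
  shows "add (quotient_space scale Z B) (coset_of B u) (coset_of B v) = coset_of B (u + v)"
proof -
  have "{a + b | a b. a \<in> coset_of B u \<and> b \<in> coset_of B v} = coset_of B (u + v)"
  proof (intro Set.set_eqI iffI)
    fix x assume "x \<in> {a + b | a b. a \<in> coset_of B u \<and> b \<in> coset_of B v}"
    then obtain b1 b2 where b: "b1 \<in> B" "b2 \<in> B" "x = (u + b1) + (v + b2)"
      by (auto simp: mem_coset_of)
    thus "x \<in> coset_of B (u + v)"
      unfolding mem_coset_of using subspace_add[OF B b(1,2)]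
      by (intro bexI[of _ "b1 + b2"]) (simp_all add: algebra_simps)
  next
    fix x assume "x \<in> coset_of B (u + v)"
    then obtain b where "b \<in> B" "x = u + (v + b)"
      by (auto simp: mem_coset_of add.assoc)
    moreover have "u \<in> coset_of B u"
      using subspace_0[OF B] by (force simp: mem_coset_of)
    moreover have "v + b \<in> coset_of B v"
      using \<open>b \<in> B\<close> by (auto simp: mem_coset_of)
    ultimately show "x \<in> {a + b | a b. a \<in> coset_of B u \<and> b \<in> coset_of B v}"
      by blast
  qed
  thus ?thesis
    by (simp add: quotient_space_def)
qed

lemma quotient_space_smult:
  assumes B: "subspace B"
  shows "module.smult (quotient_space scale Z B) c (coset_of B u) = coset_of B (scale c u)"
proof -
  have "{scale c a + b | a b. a \<in> coset_of B u \<and> b \<in> B} = coset_of B (scale c u)"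
  proof (intro Set.set_eqI iffI)
    fix x assume "x \<in> {scale c a + b | a b. a \<in> coset_of B u \<and> b \<in> B}"
    then obtain b1 b2 where b: "b1 \<in> B" "b2 \<in> B" "x = scale c (u + b1) + b2"
      by (auto simp: mem_coset_of)
    thus "x \<in> coset_of B (scale c u)"
      unfolding mem_coset_of using subspace_add[OF B subspace_scale[OF B b(1)] b(2)]
      by (intro bexI[of _ "scale c b1 + b2"]) (simp_all add: scale_right_distrib add.assoc)
  next
    fix x assume "x \<in> coset_of B (scale c u)"
    moreover have "u \<in> coset_of B u"
      using subspace_0[OF B] by (force simp: mem_coset_of)
    ultimately show "x \<in> {scale c a + b | a b. a \<in> coset_of B u \<and> b \<in> B}"
      unfolding mem_coset_of[of x] by blast
  qed
  thus ?thesis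
    by (simp add: quotient_space_def)
qed

lemma quotient_space_zero: "zero (quotient_space scale Z B) = coset_of B 0"
  by (simp add: quotient_space_def coset_of_zero)

lemma quotient_space_carrier: "carrier (quotient_space scale Z B) = coset_of B ` Z"
  by (simp add: quotient_space_def)

text \<open>The set-level operations of the record act on representatives, so closure comes from
  \<open>Z\<close> and every identity from the ambient space.\<close>

lemma vectorspace_quotient_space:
  assumes Z: "subspace Z" and B: "subspace B"
  shows "vectorspace class_ring (quotient_space scale Z B)"
proof (rule vs_criteria)
  show "field (class_ring :: 'a ring)"
    by (rule class_field)
  show "\<forall>v\<in>carrier (quotient_space scale Z B). \<exists>w\<in>carrier (quotient_space scale Z B).
          add (quotient_space scale Z B) v w = zero (quotient_space scale Z B)"
  proof
    fix v assume "v \<in> carrier (quotient_space scale Z B)"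
    then obtain u where "u \<in> Z" "v = coset_of B u"
      by (auto simp: quotient_space_carrier)
    thus "\<exists>w\<in>carrier (quotient_space scale Z B).
            add (quotient_space scale Z B) v w = zero (quotient_space scale Z B)"
      using subspace_neg[OF Z]
      by (intro bexI[of _ "coset_of B (- u)"])
         (auto simp: quotient_space_carrier quotient_space_zero quotient_space_add[OF B])
  qed
qed (auto simp: quotient_space_carrier quotient_space_zero quotient_space_add[OF B]
       quotient_space_smult[OF B] scale_right_distrib scale_left_distrib add_ac
       subspace_0[OF Z] subspace_add[OF Z] subspace_scale[OF Z])

text \<open>Transfers independence and spanning modulo \<open>B\<close> to the quotient record. A
  list indexes the coefficients by positions; two entries in the same coset would violate
  independence, so the dimension is the length.\<close>

lemma quotient_space_basis:
  assumes Z: "subspace Z" and B: "subspace B" and es: "set es \<subseteq> Z"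
    and indep: "\<And>c. (\<Sum>i<length es. scale (c i) (es ! i)) \<in> B \<Longrightarrow> \<forall>i<length es. c i = 0"
    and span: "\<And>v. v \<in> Z \<Longrightarrow> \<exists>c. v - (\<Sum>i<length es. scale (c i) (es ! i)) \<in> B"
  defines "Q \<equiv> quotient_space scale Z B"
  shows "vectorspace class_ring Q \<and> vectorspace.dim class_ring Q = length es \<and>
         vectorspace.basis class_ring Q (coset_of B ` set es)"
proof -
  define n where "n = length es"
  define C where "C = (\<lambda>i. coset_of B (es ! i))"
  interpret Q: vectorspace class_ring Q
    unfolding Q_def using Z B by (rule vectorspace_quotient_space)
  have zero_Q: "zero Q = coset_of B 0"
    and add_Q: "add Q (coset_of B u) (coset_of B v) = coset_of B (u + v)"
    and smult_Q: "module.smult Q c (coset_of B u) = coset_of B (scale c u)"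
    and carrier_Q: "carrier Q = coset_of B ` Z" for u v c
    using B by (auto simp: Q_def quotient_space_zero quotient_space_add quotient_space_smult
      quotient_space_carrier)
  have esZ: "es ! i \<in> Z" if "i < n" for i
    using es that by (auto simp: n_def)
  have C_carrier: "C i \<in> carrier Q" if "i < n" for i
    using esZ[OF that] by (auto simp: carrier_Q C_def)
  have image: "coset_of B ` set es = C ` {..<n}"
    by (auto simp: C_def n_def set_conv_nth)
  have inj: "inj_on C {..<n}"
  proof (rule inj_onI, rule ccontr)
    fix i j assume ij: "i \<in> {..<n}" "j \<in> {..<n}" "C i = C j" "i \<noteq> j"
    \<comment> \<open>The coefficients of \<open>es ! i - es ! j\<close>, a nontrivial relation
      modulo \<open>B\<close>.\<close>
    let ?c = "\<lambda>k. (if k = i then 1 else 0) - (if k = j then 1 else 0) :: 'a"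
    have "(\<Sum>k<length es. scale (?c k) (es ! k)) =
        (\<Sum>k<length es. (if k = i then es ! k else 0) - (if k = j then es ! k else 0))"
      by (intro sum.cong) auto
    also have "\<dots> = es ! i - es ! j"
      using ij by (simp add: sum_subtractf n_def)
    also have "\<dots> \<in> B"
      using ij by (simp add: C_def coset_of_eq_iff[OF B])
    finally have "\<forall>k<length es. ?c k = 0"
      by (rule indep)
    from this[rule_format, of i] show False
      using ij by (simp add: n_def)
  qed
  \<comment> \<open>Passing to cosets commutes with finite sums, which brings linear combinations in
    the quotient back to representatives.\<close>
  have finsum: "finsum Q (\<lambda>i. coset_of B (f i)) I = coset_of B (sum f I)"
    if "finite I" "f ` I \<subseteq> Z" for I and f :: "nat \<Rightarrow> 'b"
    using that
  proof (induction I)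
    case empty
    thus ?case by (simp add: zero_Q)
  next
    case (insert i I)
    hence "finsum Q (\<lambda>i. coset_of B (f i)) (insert i I)
        = add Q (coset_of B (f i)) (finsum Q (\<lambda>i. coset_of B (f i)) I)"
      by (intro Q.finsum_insert) (auto simp: carrier_Q)
    thus ?case
      using insert by (simp add: add_Q)
  qed
  \<comment> \<open>Injectivity of \<open>C\<close> lets a sum over a set of cosets be reindexed by
    positions.\<close>
  have lincomb: "Q.lincomb a (C ` {..<n}) = coset_of B (\<Sum>i<n. scale (a (C i)) (es ! i))" for a
  proof -
    have "Q.lincomb a (C ` {..<n}) = finsum Q (\<lambda>i. module.smult Q (a (C i)) (C i)) {..<n}"
      unfolding Q.lincomb_def using inj
      by (intro Q.add.finprod_reindex) (auto intro!: Q.smult_closed C_carrier)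
    also have "\<dots> = finsum Q (\<lambda>i. coset_of B (scale (a (C i)) (es ! i))) {..<n}"
      by (simp add: C_def smult_Q)
    also have "\<dots> = coset_of B (\<Sum>i<n. scale (a (C i)) (es ! i))"
      by (intro finsum) (auto intro!: subspace_scale[OF Z] esZ)
    finally show ?thesis .
  qed
  have carrier: "C ` {..<n} \<subseteq> carrier Q"
    using C_carrier by auto
  have indpt: "Q.lin_indpt (C ` {..<n})"
  proof (rule Q.finite_lin_indpt2)
    fix a assume "Q.lincomb a (C ` {..<n}) = zero Q"
    hence "(\<Sum>i<n. scale (a (C i)) (es ! i)) \<in> B"
      unfolding lincomb by (simp add: zero_Q coset_of_eq_iff[OF B])
    from indep[OF this[unfolded n_def]] show "\<forall>v\<in>C ` {..<n}. a v = zero class_ring"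
      by (auto simp: n_def)
  qed (use carrier in auto)
  have gen: "Q.gen_set (C ` {..<n})"
  proof
    show "Q.span (C ` {..<n}) \<subseteq> carrier Q"
      using carrier by (rule Q.span_is_subset2)
    show "carrier Q \<subseteq> Q.span (C ` {..<n})"
    proof
      fix X assume "X \<in> carrier Q"
      then obtain v where v: "v \<in> Z" "X = coset_of B v"
        by (auto simp: carrier_Q)
      obtain c where c: "v - (\<Sum>i<n. scale (c i) (es ! i)) \<in> B"
        using span[OF v(1)] by (auto simp: n_def)
      \<comment> \<open>\<open>lincomb\<close> takes coefficients indexed by vectors, so
        \<open>c\<close> is pulled back along the inverse of \<open>C\<close>.\<close>
      let ?a = "\<lambda>Y. c (the_inv_into {..<n} C Y)"
      have "Q.lincomb ?a (C ` {..<n}) = coset_of B (\<Sum>i<n. scale (c i) (es ! i))"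
        unfolding lincomb
        by (intro arg_cong[where f = "coset_of B"] sum.cong)
           (auto simp: the_inv_into_f_f[OF inj])
      moreover have "X = coset_of B (\<Sum>i<n. scale (c i) (es ! i))"
        using c v(2) by (simp add: coset_of_eq_iff[OF B])
      ultimately have "X = Q.lincomb ?a (C ` {..<n})"
        by simp
      thus "X \<in> Q.span (C ` {..<n})"
        unfolding Q.span_def by (intro CollectI exI[of _ ?a] exI[of _ "C ` {..<n}"]) auto
    qed
  qed
  have basis: "Q.basis (C ` {..<n})"
    unfolding Q.basis_def by (intro conjI indpt gen carrier)
  hence "Q.dim = n"
    using Q.dim_basis[of "C ` {..<n}"] card_image[OF inj] by simp
  with basis show ?thesis
    using Q.vectorspace_axioms by (simp add: image n_def)
qed

end


section \<open>Cochains of the Heisenberg algebra in coordinates\<close>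

lemma vec3_eq_iff: "(u :: 'a ^ 3) = v \<longleftrightarrow> u $ 1 = v $ 1 \<and> u $ 2 = v $ 2 \<and> u $ 3 = v $ 3"
  by (simp add: Finite_Cartesian_Product.vec_eq_iff forall_3)

text \<open>Serves as a coordinate system on the 2-cochains: existence of coordinates is
  \<open>C2_iff\<close>, uniqueness is \<open>heis_cochain_eq_iff\<close>.\<close>

definition heis_cochain ::
    "'a::field ^ 3 \<Rightarrow> 'a ^ 3 \<Rightarrow> 'a ^ 3 \<Rightarrow> 'a ^ 3 \<Rightarrow> 'a ^ 3 \<Rightarrow> 'a ^ 3 \<Rightarrow>
      ('a ^ 3 \<Rightarrow> 'a ^ 3 \<Rightarrow> 'a ^ 3) \<times> ('a ^ 3 \<Rightarrow> 'a ^ 3)" where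
  "heis_cochain a b c d e f = (heis_alt a b c, heis_semilin d e f)"

lemma heis_cochain_add:
  "heis_cochain a b c d e f + heis_cochain a' b' c' d' e' f' =
     heis_cochain (a + a') (b + b') (c + c') (d + d') (e + e') (f + f')"
  by (auto simp: heis_cochain_def heis_alt_def heis_semilin_def fun_eq_iff vec3_eq_iff algebra_simps)

lemma heis_cochain_diff:
  "heis_cochain a b c d e f - heis_cochain a' b' c' d' e' f' =
     heis_cochain (a - a') (b - b') (c - c') (d - d') (e - e') (f - f')"
  by (auto simp: heis_cochain_def heis_alt_def heis_semilin_def fun_eq_iff vec3_eq_iff algebra_simps)

lemma heis_alt_zero: "heis_alt 0 0 0 = 0"
  by (auto simp: heis_alt_def fun_eq_iff)

lemma heis_semilin_zero: "heis_semilin 0 0 0 = 0"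
  by (auto simp: heis_semilin_def fun_eq_iff)

lemma heis_cochain_zero: "heis_cochain 0 0 0 0 0 0 = 0"
  by (simp add: heis_cochain_def heis_alt_zero heis_semilin_zero zero_prod_def)

text \<open>Evaluation on basis vectors recovers all six entries. The hypothesis excludes the
  exponent 0, for which \<open>heis_semilin d e f\<close> would be the constant map with value
  \<open>d + e + f\<close>.\<close>

lemma heis_cochain_eq_iff:
  assumes "0 < CHAR('a::field)"
  shows "heis_cochain a b c d e f = heis_cochain a' b' c' d' e' (f' :: 'a ^ 3) \<longleftrightarrow>
    a = a' \<and> b = b' \<and> c = c' \<and> d = d' \<and> e = e' \<and> f = f'"
proof
  assume eq: "heis_cochain a b c d e f = heis_cochain a' b' c' d' e' f'"
  hence "heis_alt a b c u v = heis_alt a' b' c' u v" "heis_semilin d e f u = heis_semilin d' e' f' u"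
    for u v by (simp_all add: heis_cochain_def)
  from this(1)[of hx hy] this(1)[of hx hz] this(1)[of hy hz] this(2)[of hx] this(2)[of hy]
    this(2)[of hz]
  show "a = a' \<and> b = b' \<and> c = c' \<and> d = d' \<and> e = e' \<and> f = f'"
    by (simp add: heis_alt_basis heis_semilin_basis[OF assms])
qed simp

lemma vec3_eq_sum_axis: "(u :: 'a::field ^ 3) = u $ 1 *s hx + u $ 2 *s hy + u $ 3 *s hz"
  by (simp add: vec3_eq_iff axis_def)

lemma linear_vec3:
  assumes "Vector_Spaces.linear (*s) (*s) (g :: 'a::field ^ 3 \<Rightarrow> 'a ^ 3)"
  shows "g u = u $ 1 *s g hx + u $ 2 *s g hy + u $ 3 *s g hz"
proof -
  interpret g: Vector_Spaces.linear "(*s)" "(*s)" g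
    by (rule assms)
  show ?thesis
    by (subst vec3_eq_sum_axis[of u]) (simp add: g.add g.scale)
qed

text \<open>Brackets lie in the centre spanned by z, so ad_u has square zero.\<close>

lemma funpow_heis_br_zero:
  assumes "2 \<le> n"
  shows "(heis_br u ^^ n) v = 0"
proof -
  obtain m where "n = Suc (Suc m)"
    using assms by (metis Suc_le_D numeral_2_eq_2 Suc_le_mono)
  thus ?thesis
    by (simp add: heis_br_def axis_def)
qed

text \<open>The two innermost brackets already give 0 by two-step nilpotency, and the later ones
  preserve it.\<close>

lemma fold_heis_br_zero:
  assumes "2 \<le> length xs"
  shows "fold heis_br xs v = 0"
proof -
  have zero: "fold heis_br ys 0 = 0" for ys :: "('a ^ 3) list"
    by (induction ys) (auto simp: heis_br_def)
  obtain a b ys where "xs = a # b # ys"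
    using assms by (metis Suc_le_length_iff numeral_2_eq_2)
  moreover have "heis_br b (heis_br a v) = 0"
    by (simp add: heis_br_def axis_def)
  ultimately show ?thesis
    using zero by simp
qed

section \<open>Common setting for the different choices of \<theta>\<close>

locale heisenberg =
  fixes \<theta> :: "'a::field ^ 3 \<Rightarrow> 'a"
  assumes char_gt_3: "3 < CHAR('a)"
begin

sublocale restricted_lie_algebra "(*s)" heis_br "heis_pmap \<theta>"
  using char_gt_3 by (rule restricted_lie_algebra_heis)

sublocale cochains: vector_space cochain_scale
  by unfold_locales (auto simp: cochain_scale_def fun_eq_iff vec3_eq_iff algebra_simps)

lemma prime_char: "prime CHAR('a)"
  using char_gt_3 by (intro prime_CHAR_semidom) auto

text \<open>A prime above 3 is not 4. With p at least 5, a left-normed bracket of p - 2 entries has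
  length at least 3 and vanishes, as \<open>star_sum_zero\<close> requires.\<close>

lemma char_ge_5: "5 \<le> CHAR('a)"
proof -
  have "CHAR('a) \<noteq> 4"
    using prime_odd_nat[OF prime_char] char_gt_3 by auto
  thus ?thesis
    using char_gt_3 by linarith
qed

lemma char_pos: "0 < CHAR('a)"
  using char_gt_3 by simp

lemma heis_cochain_scale:
  "cochain_scale k (heis_cochain a b c d e f) =
     heis_cochain (k *s a) (k *s b) (k *s c) (k *s d) (k *s e) (k *s f)"
  by (auto simp: cochain_scale_def heis_cochain_def heis_alt_def heis_semilin_def fun_eq_iff
    vec3_eq_iff algebra_simps)

section \<open>Coordinates for 2-cochains\<close>

lemma CE2_iff: "\<phi> \<in> CE2 \<longleftrightarrow> (\<exists>a b c. \<phi> = heis_alt a b c)"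
proof
  assume "\<phi> \<in> CE2"
  hence linear: "Vector_Spaces.linear (*s) (*s) (\<phi> u)"
      "Vector_Spaces.linear (*s) (*s) (\<lambda>u. \<phi> u v)" and diag: "\<phi> u u = 0" for u v
    by (auto simp: CE2_def)
  \<comment> \<open>Polarizing \<open>\<phi> u u = 0\<close> gives skew-symmetry, which cuts the
    nine values on basis pairs down to three.\<close>
  have skew: "\<phi> v u = - \<phi> u v" for u v
  proof -
    interpret l: Vector_Spaces.linear "(*s)" "(*s)" "\<phi> w" for w
      by (rule linear)
    interpret r: Vector_Spaces.linear "(*s)" "(*s)" "\<lambda>u. \<phi> u w" for w
      by (rule linear)
    have "\<phi> (u + v) (u + v) = \<phi> u u + \<phi> v v + \<phi> u v + \<phi> v u"
      by (simp only: l.add r.add add_ac)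
    thus ?thesis
      by (simp add: diag eq_neg_iff_add_eq_0 add.commute)
  qed
  have "\<phi> u v = heis_alt (\<phi> hx hy) (\<phi> hx hz) (\<phi> hy hz) u v" for u v
  proof -
    have "\<phi> w v = v $ 1 *s \<phi> w hx + v $ 2 *s \<phi> w hy + v $ 3 *s \<phi> w hz" for w
      by (rule linear_vec3) (rule linear)
    hence "\<phi> u v = u $ 1 *s (v $ 1 *s \<phi> hx hx + v $ 2 *s \<phi> hx hy + v $ 3 *s \<phi> hx hz)
        + u $ 2 *s (v $ 1 *s \<phi> hy hx + v $ 2 *s \<phi> hy hy + v $ 3 *s \<phi> hy hz)
        + u $ 3 *s (v $ 1 *s \<phi> hz hx + v $ 2 *s \<phi> hz hy + v $ 3 *s \<phi> hz hz)"
      using linear_vec3[OF linear(2), of u v] by simp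
    thus ?thesis
      unfolding heis_alt_def skew[of hy hx] skew[of hz hx] skew[of hz hy] diag
      by (simp add: vec3_eq_iff algebra_simps)
  qed
  thus "\<exists>a b c. \<phi> = heis_alt a b c"
    by blast
next
  assume "\<exists>a b c. \<phi> = heis_alt a b c"
  then obtain a b c where \<phi>: "\<phi> = heis_alt a b c"
    by blast
  have "Vector_Spaces.linear (*s) (*s) (heis_alt a b c u)"
    "Vector_Spaces.linear (*s) (*s) (\<lambda>u. heis_alt a b c u v)" for u v
    by (unfold_locales; simp add: heis_alt_def vec3_eq_iff algebra_simps)+
  thus "\<phi> \<in> CE2"
    by (simp add: CE2_def \<phi>) (simp add: heis_alt_def)
qed

text \<open>For k at least 2 the outer brackets kill the term; for k at most 1 the left-normed
  bracket inside has at least p - 2 entries and is 0.\<close>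

lemma star_sum_zero:
  assumes "length xs = CHAR('a)"
  shows "star_sum (heis_alt a b c) xs = 0"
proof -
  have zero: "heis_br u 0 = 0" "heis_alt a b c 0 u = 0" for u
    by (simp_all add: heis_br_def heis_alt_def)
  have "fold heis_br (drop (CHAR('a) - k) xs)
      (heis_alt a b c (left_normed heis_br (take (CHAR('a) - k - 1) xs)) (xs ! (CHAR('a) - k - 1))) = 0"
    if "k \<le> CHAR('a) - 2" for k
  proof (cases "2 \<le> k")
    case True
    thus ?thesis
      using assms that by (intro fold_heis_br_zero) simp
  next
    case False
    hence "left_normed heis_br (take (CHAR('a) - k - 1) xs) = 0"
      using assms char_ge_5 by (intro left_normed_heis_br) simp
    moreover have "fold heis_br ys 0 = 0" for ys :: "('a ^ 3) list"
      by (induction ys) (simp_all add: zero)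
    ultimately show ?thesis
      by (simp add: zero)
  qed
  thus ?thesis
    by (simp add: star_sum_def Let_def)
qed

text \<open>Since the correction sum vanishes, \<omega> is constrained independently of \<phi>: it
  is exactly a p-semilinear map, given by its values on the basis.\<close>

lemma C2_iff: "x \<in> C2 \<longleftrightarrow> (\<exists>a b c d e f. x = heis_cochain a b c d e f)"
proof -
  have star: "(\<Sum>w\<in>uv_words CHAR('a). inverse (of_nat (count_list w True)) *s
      star_sum (heis_alt a b c) (subst_uv u v w)) = 0" for a b c u v
    by (intro sum.neutral) (auto simp: uv_words_def subst_uv_def star_sum_zero)
  have semilin: "(\<forall>c u. \<omega> (c *s u) = (c ^ CHAR('a)) *s \<omega> u) \<and> (\<forall>u v. \<omega> (u + v) = \<omega> u + \<omega> v)
      \<longleftrightarrow> (\<exists>d e f. \<omega> = heis_semilin d e f)" for \<omega> :: "'a ^ 3 \<Rightarrow> 'a ^ 3"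
  proof
    assume "(\<forall>c u. \<omega> (c *s u) = (c ^ CHAR('a)) *s \<omega> u) \<and> (\<forall>u v. \<omega> (u + v) = \<omega> u + \<omega> v)"
    hence "\<omega> (u $ 1 *s hx + u $ 2 *s hy + u $ 3 *s hz) = heis_semilin (\<omega> hx) (\<omega> hy) (\<omega> hz) u" for u
      by (simp add: heis_semilin_def)
    thus "\<exists>d e f. \<omega> = heis_semilin d e f"
      unfolding vec3_eq_sum_axis[symmetric] by blast
  next
    assume "\<exists>d e f. \<omega> = heis_semilin d e f"
    thus "(\<forall>c u. \<omega> (c *s u) = (c ^ CHAR('a)) *s \<omega> u) \<and> (\<forall>u v. \<omega> (u + v) = \<omega> u + \<omega> v)"
      by (auto simp: heis_semilin_def vec3_eq_iff freshmans_dream[OF prime_char] power_mult_distrib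
        algebra_simps)
  qed
  show ?thesis
  proof (cases x)
    case (Pair \<phi> \<omega>)
    show ?thesis
    proof (cases "\<phi> \<in> CE2")
      case True
      then obtain a b c where \<phi>: "\<phi> = heis_alt a b c"
        by (auto simp: CE2_iff)
      have "x \<in> C2 \<longleftrightarrow> (\<exists>d e f. \<omega> = heis_semilin d e f)"
        unfolding semilin[symmetric] using True by (simp add: C2_def Pair \<phi> star)
      thus ?thesis
        using \<phi> by (auto simp: Pair heis_cochain_def)
    next
      case False
      thus ?thesis
        unfolding Pair by (auto simp: C2_def heis_cochain_def CE2_iff)
    qed
  qed
qed

section \<open>Cocycle conditions\<close>

lemma ind2_eq: "ind2 (heis_alt a b c) \<omega> u v = - heis_alt a b c u (heis_pmap \<theta> v) - heis_br u (\<omega> v)"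
proof -
  \<comment> \<open>For i at least 2 the operator ad_v^i is 0; for i at most 1 the inner bracket has
    j + 1, hence at least p - 1, entries and is 0.\<close>
  have "(heis_br v ^^ i) (heis_alt a b c (left_normed heis_br (u # replicate j v)) v) = 0"
    if "i + j = CHAR('a) - 1" for i j
  proof (cases "2 \<le> i")
    case True
    thus ?thesis
      by (rule funpow_heis_br_zero)
  next
    case False
    hence "left_normed heis_br (u # replicate j v) = 0"
      using that char_ge_5 by (intro left_normed_heis_br) simp
    moreover have "(heis_br v ^^ i) 0 = 0"
      by (induction i) (simp_all add: heis_br_def)
    ultimately show ?thesis
      by (simp add: heis_alt_def)
  qed
  hence "(\<Sum>(i, j) \<in> {(i, j). i + j = CHAR('a) - 1}. ((-1) ^ i) *s
      (heis_br v ^^ i) (heis_alt a b c (left_normed heis_br (u # replicate j v)) v)) = 0"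
    by (intro sum.neutral) auto
  thus ?thesis
    by (simp add: ind2_def)
qed

text \<open>In dimension 3 an alternating trilinear map is governed by its value at (x, y, z), here
  [x, c] - [y, b] = (c_2 + b_1) z.\<close>

lemma d2_eq_zero_iff: "(\<forall>u v w. d2 (heis_alt a b c) u v w = 0) \<longleftrightarrow> c $ 2 + b $ 1 = 0"
proof
  assume "\<forall>u v w. d2 (heis_alt a b c) u v w = 0"
  hence "d2 (heis_alt a b c) hx hy hz $ 3 = 0"
    by simp
  thus "c $ 2 + b $ 1 = 0"
    by (simp add: d2_def heis_alt_def heis_br_def axis_def)
next
  assume "c $ 2 + b $ 1 = 0"
  hence "c $ 2 = - b $ 1"
    by (simp add: eq_neg_iff_add_eq_0)
  thus "\<forall>u v w. d2 (heis_alt a b c) u v w = 0"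
    by (simp add: d2_def heis_alt_def heis_br_def axis_def vec3_eq_iff algebra_simps)
qed

text \<open>For a basis vector v, the pair \<open>(t, g)\<close> is (\<theta>(v), \<omega>(v)), so
  the p-map sends v to t z. The two equations are the conditions for u = x and u = y; u = z gives
  nothing, as z is central.\<close>

lemma ind2_eq_zero_iff:
  "(\<forall>u v. ind2 (heis_alt a b c) (heis_semilin d e f) u v = 0) \<longleftrightarrow>
     (\<forall>(t, g) \<in> {(\<theta> hx, d), (\<theta> hy, e), (\<theta> hz, f)}.
        t *s b = - g $ 2 *s hz \<and> t *s c = g $ 1 *s hz)"
proof
  assume "\<forall>u v. ind2 (heis_alt a b c) (heis_semilin d e f) u v = 0"
  hence *: "heis_alt a b c u (heis_pmap \<theta> v) = - heis_br u (heis_semilin d e f v)" for u v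
    by (simp add: ind2_eq eq_neg_iff_add_eq_0 neg_eq_iff_add_eq_0)
  show "\<forall>(t, g) \<in> {(\<theta> hx, d), (\<theta> hy, e), (\<theta> hz, f)}.
        t *s b = - g $ 2 *s hz \<and> t *s c = g $ 1 *s hz"
    using *[of hx hx] *[of hy hx] *[of hx hy] *[of hy hy] *[of hx hz] *[of hy hz] char_pos
    unfolding heis_semilin_basis[OF char_pos]
    by (simp add: heis_alt_def heis_br_def heis_pmap_def axis_def vec3_eq_iff zero_power)
next
  assume *: "\<forall>(t, g) \<in> {(\<theta> hx, d), (\<theta> hy, e), (\<theta> hz, f)}.
        t *s b = - g $ 2 *s hz \<and> t *s c = g $ 1 *s hz"
  show "\<forall>u v. ind2 (heis_alt a b c) (heis_semilin d e f) u v = 0"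
  proof (intro allI)
    fix u v :: "'a ^ 3"
    let ?q = "\<lambda>i. v $ i ^ CHAR('a)"
    \<comment> \<open>Grouping by the products of \<theta>-values with \<open>b\<close> and
      \<open>c\<close> makes the assumed equations applicable as rewrite rules.\<close>
    have "heis_alt a b c u (heis_pmap \<theta> v) =
        u $ 1 *s (?q 1 *s (\<theta> hx *s b) + ?q 2 *s (\<theta> hy *s b) + ?q 3 *s (\<theta> hz *s b))
      + u $ 2 *s (?q 1 *s (\<theta> hx *s c) + ?q 2 *s (\<theta> hy *s c) + ?q 3 *s (\<theta> hz *s c))"
      by (simp add: heis_alt_def heis_pmap_def axis_def vec3_eq_iff algebra_simps)
    also have "\<dots> =
        u $ 1 *s (?q 1 *s (- d $ 2 *s hz) + ?q 2 *s (- e $ 2 *s hz) + ?q 3 *s (- f $ 2 *s hz))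
      + u $ 2 *s (?q 1 *s (d $ 1 *s hz) + ?q 2 *s (e $ 1 *s hz) + ?q 3 *s (f $ 1 *s hz))"
      using * by simp
    also have "\<dots> = - heis_br u (heis_semilin d e f v)"
      by (simp add: heis_br_def heis_semilin_def vec3_eq_iff algebra_simps)
    finally show "ind2 (heis_alt a b c) (heis_semilin d e f) u v = 0"
      by (simp add: ind2_eq)
  qed
qed

lemma Z2_iff:
  "heis_cochain a b c d e f \<in> Z2 \<longleftrightarrow> c $ 2 + b $ 1 = 0 \<and>
     (\<forall>(t, g) \<in> {(\<theta> hx, d), (\<theta> hy, e), (\<theta> hz, f)}.
        t *s b = - g $ 2 *s hz \<and> t *s c = g $ 1 *s hz)"
proof -
  have "heis_cochain a b c d e f \<in> C2"
    unfolding C2_iff by blast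
  thus ?thesis
    by (simp add: Z2_def heis_cochain_def d2_eq_zero_iff ind2_eq_zero_iff
      del: split_paired_Ball_Sigma)
qed

section \<open>Coboundaries\<close>

lemma coboundary_eq:
  assumes "Vector_Spaces.linear (*s) (*s) \<psi>"
  defines "s \<equiv> \<psi> hz"
  shows "(d1 \<psi>, ind1 \<psi>) = heis_cochain ((\<psi> hx $ 1 + \<psi> hy $ 2) *s hz - s) (s $ 2 *s hz) (- s $ 1 *s hz)
    (- \<theta> hx *s s) (- \<theta> hy *s s) (- \<theta> hz *s s)"
proof -
  have \<psi>: "\<psi> u = u $ 1 *s \<psi> hx + u $ 2 *s \<psi> hy + u $ 3 *s s" for u
    unfolding s_def using assms(1) by (rule linear_vec3)
  \<comment> \<open>The value on (x, y) is [x, \<psi>(y)] - [y, \<psi>(x)] - s; on (x, z) and (y, z)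
    only [x, s] and [y, s] survive.\<close>
  have "d1 \<psi> u v = heis_alt ((\<psi> hx $ 1 + \<psi> hy $ 2) *s hz - s) (s $ 2 *s hz) (- s $ 1 *s hz) u v" for u v
    unfolding d1_def \<psi>[of "heis_br u v"] \<psi>[of u] \<psi>[of v]
    by (simp add: heis_br_def heis_alt_def axis_def vec3_eq_iff algebra_simps)
  \<comment> \<open>The ad-power term vanishes since p - 1 is at least 2, leaving only -\<psi> on a
    multiple of z.\<close>
  moreover have "ind1 \<psi> u = heis_semilin (- \<theta> hx *s s) (- \<theta> hy *s s) (- \<theta> hz *s s) u" for u
    unfolding ind1_def \<psi>[of "heis_pmap \<theta> u"] using char_gt_3
    by (simp add: funpow_heis_br_zero heis_pmap_def heis_semilin_def axis_def vec3_eq_iff algebra_simps)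
  ultimately show ?thesis
    by (simp add: heis_cochain_def fun_eq_iff)
qed

text \<open>The two parameters of \<open>coboundary_eq\<close>, the vector \<open>s\<close> and the
  diagonal sum \<open>t\<close>, can be prescribed independently.\<close>

lemma B2_iff:
  "x \<in> B2 \<longleftrightarrow> (\<exists>s t. x = heis_cochain (t *s hz - s) (s $ 2 *s hz) (- s $ 1 *s hz)
     (- \<theta> hx *s s) (- \<theta> hy *s s) (- \<theta> hz *s s))"
proof
  assume "x \<in> B2"
  thus "\<exists>s t. x = heis_cochain (t *s hz - s) (s $ 2 *s hz) (- s $ 1 *s hz)
     (- \<theta> hx *s s) (- \<theta> hy *s s) (- \<theta> hz *s s)"
    unfolding B2_def using coboundary_eq by blast
next
  assume "\<exists>s t. x = heis_cochain (t *s hz - s) (s $ 2 *s hz) (- s $ 1 *s hz)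
     (- \<theta> hx *s s) (- \<theta> hy *s s) (- \<theta> hz *s s)"
  then obtain s t where x: "x = heis_cochain (t *s hz - s) (s $ 2 *s hz) (- s $ 1 *s hz)
     (- \<theta> hx *s s) (- \<theta> hy *s s) (- \<theta> hz *s s)"
    by blast
  \<comment> \<open>Sends x to t x, y to 0 and z to s.\<close>
  define \<psi> where "\<psi> = (\<lambda>u :: 'a ^ 3. u $ 1 *s (t *s hx) + u $ 3 *s s)"
  have "Vector_Spaces.linear (*s) (*s) \<psi>"
    by unfold_locales (simp_all add: \<psi>_def vec3_eq_iff algebra_simps)
  moreover have "\<psi> hx $ 1 + \<psi> hy $ 2 = t" "\<psi> hz = s"
    by (simp_all add: \<psi>_def axis_def)
  ultimately have "x = (d1 \<psi>, ind1 \<psi>)"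
    by (simp add: x coboundary_eq)
  thus "x \<in> B2"
    using \<open>Vector_Spaces.linear (*s) (*s) \<psi>\<close> by (auto simp: B2_def)
qed

lemma Z2_cases:
  assumes "x \<in> Z2"
  obtains a b c d e f where "x = heis_cochain a b c d e f"
proof -
  from assms have "x \<in> C2"
    by (auto simp: Z2_def)
  thus ?thesis
    using that by (auto simp: C2_iff)
qed

section \<open>Cocycles and coboundaries as subspaces\<close>

lemma subspace_Z2: "cochains.subspace Z2"
proof (rule cochains.subspaceI)
  show "0 \<in> Z2"
    unfolding heis_cochain_zero[symmetric] Z2_iff by simp
next
  fix x y assume xy: "x \<in> Z2" "y \<in> Z2"
  obtain a b c d e f where x: "x = heis_cochain a b c d e f"
    using xy(1) by (rule Z2_cases)
  obtain a' b' c' d' e' f' where y: "y = heis_cochain a' b' c' d' e' f'"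
    using xy(2) by (rule Z2_cases)
  have "c $ 2 + c' $ 2 + (b $ 1 + b' $ 1) = (c $ 2 + b $ 1) + (c' $ 2 + b' $ 1)"
    by simp
  thus "x + y \<in> Z2"
    using xy unfolding x y heis_cochain_add Z2_iff
    by (simp add: vector_add_ldistrib vector_sadd_rdistrib)
next
  fix k x assume xZ: "x \<in> Z2"
  obtain a b c d e f where x: "x = heis_cochain a b c d e f"
    using xZ by (rule Z2_cases)
  have "k * c $ 2 + k * b $ 1 = k * (c $ 2 + b $ 1)"
    by (simp add: distrib_left)
  \<comment> \<open>The equations for \<open>c\<close> and \<open>b\<close> are homogeneous; the two
    signs are treated separately.\<close>
  moreover have "t *s (k *s w) = (k * r) *s hz" if "t *s w = r *s hz" for t r and w :: "'a ^ 3"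
    using arg_cong[OF that, of "(*s) k"] by (simp add: vector_smult_assoc mult.commute)
  moreover from this[where r = "- _"]
  have "t *s (k *s w) = - ((k * r) *s hz)" if "t *s w = - (r *s hz)" for t r and w :: "'a ^ 3"
    using that by simp
  ultimately show "cochain_scale k x \<in> Z2"
    using xZ unfolding x heis_cochain_scale Z2_iff
    by simp
qed

text \<open>The parametrisation in \<open>B2_iff\<close> is linear in the pair (s, t).\<close>

lemma subspace_B2: "cochains.subspace B2"
proof (rule cochains.subspaceI)
  show "0 \<in> B2"
    unfolding heis_cochain_zero[symmetric] B2_iff by (intro exI[of _ 0]) simp
next
  fix x y assume "x \<in> B2" "y \<in> B2"
  then obtain s t s' t' where
    "x = heis_cochain (t *s hz - s) (s $ 2 *s hz) (- s $ 1 *s hz)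
      (- \<theta> hx *s s) (- \<theta> hy *s s) (- \<theta> hz *s s)"
    "y = heis_cochain (t' *s hz - s') (s' $ 2 *s hz) (- s' $ 1 *s hz)
      (- \<theta> hx *s s') (- \<theta> hy *s s') (- \<theta> hz *s s')"
    unfolding B2_iff by blast
  thus "x + y \<in> B2"
    unfolding B2_iff
    by (intro exI[of _ "s + s'"] exI[of _ "t + t'"])
       (simp add: heis_cochain_add heis_cochain_eq_iff[OF char_pos] vec3_eq_iff algebra_simps)
next
  fix k x assume "x \<in> B2"
  then obtain s t where
    "x = heis_cochain (t *s hz - s) (s $ 2 *s hz) (- s $ 1 *s hz)
      (- \<theta> hx *s s) (- \<theta> hy *s s) (- \<theta> hz *s s)"
    unfolding B2_iff by blast
  thus "cochain_scale k x \<in> B2"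
    unfolding B2_iff
    by (intro exI[of _ "k *s s"] exI[of _ "k * t"])
       (simp add: heis_cochain_scale heis_cochain_eq_iff[OF char_pos] vec3_eq_iff algebra_simps)
qed

section \<open>Cohomology classes in coordinates\<close>

lemma heis_class_alt: "heis_class \<theta> (heis_alt a b c) 0 = coset_of B2 (heis_cochain a b c 0 0 0)"
  by (simp add: heis_class_def H2_class_def heis_cochain_def heis_semilin_zero)

lemma heis_class_semilin: "heis_class \<theta> 0 (heis_semilin d e f) = coset_of B2 (heis_cochain 0 0 0 d e f)"
  by (simp add: heis_class_def H2_class_def heis_cochain_def heis_alt_zero)

lemma heis_H2_basis:
  assumes "set es \<subseteq> Z2"
    and "\<And>c. (\<Sum>i<length es. cochain_scale (c i) (es ! i)) \<in> B2 \<Longrightarrow> \<forall>i<length es. c i = 0"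
    and "\<And>v. v \<in> Z2 \<Longrightarrow> \<exists>c. v - (\<Sum>i<length es. cochain_scale (c i) (es ! i)) \<in> B2"
  shows "vectorspace class_ring (heis_H2 \<theta>) \<and> vectorspace.dim class_ring (heis_H2 \<theta>) = length es \<and>
         vectorspace.basis class_ring (heis_H2 \<theta>) (coset_of B2 ` set es)"
  unfolding heis_H2_def H2_def
  using subspace_Z2 subspace_B2 assms by (rule cochains.quotient_space_basis)

end

theorem theorem5p7:
  assumes "3 < CHAR('a::field)"
  shows
    "(let \<theta> = (0 :: 'a ^ 3 \<Rightarrow> 'a); H = heis_H2 \<theta>; cls = heis_class \<theta> in
        vectorspace class_ring H \<and> vectorspace.dim class_ring H = 8 \<and>
        vectorspace.basis class_ring H
          {cls (heis_alt 0 hz 0) 0,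
           cls (heis_alt 0 0 hz) 0,
           cls (heis_alt 0 hx (- hy)) 0,
           cls (heis_alt 0 hy 0) 0,
           cls (heis_alt 0 0 hx) 0,
           cls 0 (heis_semilin hz 0 0),
           cls 0 (heis_semilin 0 hz 0),
           cls 0 (heis_semilin 0 0 hz)}) \<and>
     (let \<theta> = (x_dual :: 'a ^ 3 \<Rightarrow> 'a); H = heis_H2 \<theta>; cls = heis_class \<theta> in
        vectorspace class_ring H \<and> vectorspace.dim class_ring H = 4 \<and>
        vectorspace.basis class_ring H
          {cls (heis_alt hx 0 0) 0,
           cls (heis_alt hy 0 0) 0,
           cls 0 (heis_semilin 0 hz 0),
           cls 0 (heis_semilin 0 0 hz)}) \<and>
     (let \<theta> = (z_dual :: 'a ^ 3 \<Rightarrow> 'a); H = heis_H2 \<theta>; cls = heis_class \<theta> in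
        vectorspace class_ring H \<and> vectorspace.dim class_ring H = 4 \<and>
        vectorspace.basis class_ring H
          {cls (heis_alt hx 0 0) 0,
           cls (heis_alt hy 0 0) 0,
           cls 0 (heis_semilin 0 hz 0),
           cls 0 (heis_semilin hz 0 0)})"
proof (intro conjI, goal_cases)

  \<comment> \<open>The zero form\<close>
  case 1
  show ?case
  proof -
    interpret h: heisenberg "0 :: 'a ^ 3 \<Rightarrow> 'a"
      using assms by unfold_locales
    define es :: "(('a ^ 3 \<Rightarrow> 'a ^ 3 \<Rightarrow> 'a ^ 3) \<times> ('a ^ 3 \<Rightarrow> 'a ^ 3)) list" where
      "es = [heis_cochain 0 hz 0 0 0 0,
        heis_cochain 0 0 hz 0 0 0,
        heis_cochain 0 hx (- hy) 0 0 0,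
        heis_cochain 0 hy 0 0 0 0,
        heis_cochain 0 0 hx 0 0 0,
        heis_cochain 0 0 0 hz 0 0,
        heis_cochain 0 0 0 0 hz 0,
        heis_cochain 0 0 0 0 0 hz]"
    \<comment> \<open>The p-map is zero, so \<omega> takes values in the centre on the basis and
      \<open>b\<close>, \<open>c\<close> satisfy one joint equation: dimension 3 + 5 + 3 =
      11.\<close>
    have Z2: "heis_cochain a b c d e f \<in> h.Z2 \<longleftrightarrow> c $ 2 + b $ 1 = 0 \<and>
        (\<forall>g \<in> {d, e, f}. g $ 1 = 0 \<and> g $ 2 = 0)"
      for a b c d e f
      by (auto simp: h.Z2_iff vec3_eq_iff axis_def)
    \<comment> \<open>The entry \<open>a\<close> is arbitrary and determines the coboundary:
      dimension 3, which leaves 8 for the quotient.\<close>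
    have B2: "heis_cochain a b c d e f \<in> h.B2 \<longleftrightarrow> b = - a $ 2 *s hz \<and> c = a $ 1 *s hz \<and> d = 0 \<and> e = 0 \<and> f = 0"
      for a b c d e f
    proof
      assume "heis_cochain a b c d e f \<in> h.B2"
      thus "b = - a $ 2 *s hz \<and> c = a $ 1 *s hz \<and> d = 0 \<and> e = 0 \<and> f = 0"
        by (auto simp: h.B2_iff heis_cochain_eq_iff[OF h.char_pos] vec3_eq_iff axis_def)
    next
      assume "b = - a $ 2 *s hz \<and> c = a $ 1 *s hz \<and> d = 0 \<and> e = 0 \<and> f = 0"
      thus "heis_cochain a b c d e f \<in> h.B2"
        unfolding h.B2_iff heis_cochain_eq_iff[OF h.char_pos]
        by (intro exI[of _ "- a"] exI[of _ "0"])
           (auto simp: vec3_eq_iff axis_def)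
    qed
    have sum: "(\<Sum>i<length es. h.cochain_scale (k i) (es ! i)) =
        heis_cochain 0 (k 0 *s hz + k 2 *s hx + k 3 *s hy) (k 1 *s hz - k 2 *s hy + k 4 *s hx)
          (k 5 *s hz) (k 6 *s hz) (k 7 *s hz)" for k
      by (simp add: es_def h.heis_cochain_scale heis_cochain_add heis_cochain_eq_iff[OF h.char_pos]
        vec3_eq_iff eval_nat_numeral)
    have "set es \<subseteq> h.Z2"
      by (simp add: es_def Z2 axis_def)
    moreover have "\<forall>i<length es. k i = 0"
      if "(\<Sum>i<length es. h.cochain_scale (k i) (es ! i)) \<in> h.B2" for k
      using that unfolding sum B2
      by (simp add: es_def All_less_Suc vec3_eq_iff axis_def eval_nat_numeral)
    moreover have "\<exists>k. v - (\<Sum>i<length es. h.cochain_scale (k i) (es ! i)) \<in> h.B2"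
      if v: "v \<in> h.Z2" for v
    proof -
      obtain a b c d e f where "v = heis_cochain a b c d e f"
        using v by (rule h.Z2_cases)
      thus ?thesis
        using v unfolding sum
        \<comment> \<open>The remainder must satisfy b = -a_2 z and c = a_1 z, which fixes every
          coefficient; the y-component of the remainder of \<open>c\<close> is zero by c_2 + b_1 =
          0.\<close>
        by (intro exI[of _ "(!) [b $ 3 + a $ 2, c $ 3 - a $ 1, b $ 1, b $ 2, c $ 1, d $ 3, e $ 3, f $ 3]"])
           (auto simp: heis_cochain_diff Z2 B2 vec3_eq_iff axis_def eq_neg_iff_add_eq_0)
    qed
    ultimately show ?thesis
      using h.heis_H2_basis[of es]
      by (simp add: Let_def es_def h.heis_class_alt h.heis_class_semilin)
  qed
next

  \<comment> \<open>The form dual to x\<close>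
  case 2
  show ?case
  proof -
    interpret h: heisenberg "x_dual :: 'a ^ 3 \<Rightarrow> 'a"
      using assms by unfold_locales
    define es :: "(('a ^ 3 \<Rightarrow> 'a ^ 3 \<Rightarrow> 'a ^ 3) \<times> ('a ^ 3 \<Rightarrow> 'a ^ 3)) list" where
      "es = [heis_cochain hx 0 0 0 0 0, heis_cochain hy 0 0 0 0 0,
        heis_cochain 0 0 0 0 hz 0, heis_cochain 0 0 0 0 0 hz]"
    \<comment> \<open>Now \<theta>(x) = 1, so \<open>d\<close> determines \<open>b\<close> and
      \<open>c\<close>, and c_2 + b_1 = 0 follows. Free are \<open>a\<close>, \<open>d\<close> and
      the z-components of \<open>e\<close> and \<open>f\<close>: dimension 8.\<close>
    have Z2: "heis_cochain a b c d e f \<in> h.Z2 \<longleftrightarrow> b = - d $ 2 *s hz \<and> c = d $ 1 *s hz \<and>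
        e $ 1 = 0 \<and> e $ 2 = 0 \<and> f $ 1 = 0 \<and> f $ 2 = 0"
      for a b c d e f
      by (auto simp: h.Z2_iff vec3_eq_iff axis_def x_dual_def)
    \<comment> \<open>Here s = -d, while t makes a_3 arbitrary: dimension 4.\<close>
    have B2: "heis_cochain a b c d e f \<in> h.B2 \<longleftrightarrow> a $ 1 = d $ 1 \<and> a $ 2 = d $ 2 \<and> b = - d $ 2 *s hz \<and>
        c = d $ 1 *s hz \<and> e = 0 \<and> f = 0"
      for a b c d e f
    proof
      assume "heis_cochain a b c d e f \<in> h.B2"
      thus "a $ 1 = d $ 1 \<and> a $ 2 = d $ 2 \<and> b = - d $ 2 *s hz \<and>
        c = d $ 1 *s hz \<and> e = 0 \<and> f = 0"
        by (auto simp: h.B2_iff heis_cochain_eq_iff[OF h.char_pos] vec3_eq_iff axis_def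
          x_dual_def)
    next
      assume "a $ 1 = d $ 1 \<and> a $ 2 = d $ 2 \<and> b = - d $ 2 *s hz \<and>
        c = d $ 1 *s hz \<and> e = 0 \<and> f = 0"
      thus "heis_cochain a b c d e f \<in> h.B2"
        unfolding h.B2_iff heis_cochain_eq_iff[OF h.char_pos]
        \<comment> \<open>The value \<omega>(x) = -s fixes s, and then the third component of a = t
          z - s fixes t.\<close>
        by (intro exI[of _ "- d"] exI[of _ "a $ 3 - d $ 3"])
           (auto simp: vec3_eq_iff axis_def x_dual_def)
    qed
    have sum: "(\<Sum>i<length es. h.cochain_scale (k i) (es ! i)) =
        heis_cochain (k 0 *s hx + k 1 *s hy) 0 0 0 (k 2 *s hz) (k 3 *s hz)" for k
      by (simp add: es_def h.heis_cochain_scale heis_cochain_add heis_cochain_eq_iff[OF h.char_pos]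
        vec3_eq_iff eval_nat_numeral)
    have "set es \<subseteq> h.Z2"
      by (simp add: es_def Z2 axis_def)
    moreover have "\<forall>i<length es. k i = 0"
      if "(\<Sum>i<length es. h.cochain_scale (k i) (es ! i)) \<in> h.B2" for k
      using that unfolding sum B2
      by (simp add: es_def All_less_Suc vec3_eq_iff axis_def eval_nat_numeral)
    moreover have "\<exists>k. v - (\<Sum>i<length es. h.cochain_scale (k i) (es ! i)) \<in> h.B2"
      if v: "v \<in> h.Z2" for v
    proof -
      obtain a b c d e f where "v = heis_cochain a b c d e f"
        using v by (rule h.Z2_cases)
      thus ?thesis
        using v unfolding sum
        \<comment> \<open>Subtracting the coboundary with s = -d clears \<open>d\<close>,
          \<open>b\<close> and \<open>c\<close> and shifts a_1 and a_2 by -d_1 and -d_2.\<close>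
        by (intro exI[of _ "(!) [a $ 1 - d $ 1, a $ 2 - d $ 2, e $ 3, f $ 3]"])
           (auto simp: heis_cochain_diff Z2 B2 vec3_eq_iff axis_def eq_neg_iff_add_eq_0)
    qed
    ultimately show ?thesis
      using h.heis_H2_basis[of es]
      by (simp add: Let_def es_def h.heis_class_alt h.heis_class_semilin)
  qed
next

  \<comment> \<open>The form dual to z\<close>
  case 3
  show ?case
  proof -
    interpret h: heisenberg "z_dual :: 'a ^ 3 \<Rightarrow> 'a"
      using assms by unfold_locales
    define es :: "(('a ^ 3 \<Rightarrow> 'a ^ 3 \<Rightarrow> 'a ^ 3) \<times> ('a ^ 3 \<Rightarrow> 'a ^ 3)) list" where
      "es = [heis_cochain hx 0 0 0 0 0, heis_cochain hy 0 0 0 0 0,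
        heis_cochain 0 0 0 0 hz 0, heis_cochain 0 0 0 hz 0 0]"
    \<comment> \<open>Now \<theta>(z) = 1: \<open>f\<close> determines \<open>b\<close> and
      \<open>c\<close>, while \<open>d\<close> is confined to the centre. The rest is the case of
      \<open>x_dual\<close> with \<open>d\<close> and \<open>f\<close> exchanged.\<close>
    have Z2: "heis_cochain a b c d e f \<in> h.Z2 \<longleftrightarrow> b = - f $ 2 *s hz \<and> c = f $ 1 *s hz \<and>
        e $ 1 = 0 \<and> e $ 2 = 0 \<and> d $ 1 = 0 \<and> d $ 2 = 0"
      for a b c d e f
      by (auto simp: h.Z2_iff vec3_eq_iff axis_def z_dual_def)
    have B2: "heis_cochain a b c d e f \<in> h.B2 \<longleftrightarrow> a $ 1 = f $ 1 \<and> a $ 2 = f $ 2 \<and> b = - f $ 2 *s hz \<and>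
        c = f $ 1 *s hz \<and> e = 0 \<and> d = 0"
      for a b c d e f
    proof
      assume "heis_cochain a b c d e f \<in> h.B2"
      thus "a $ 1 = f $ 1 \<and> a $ 2 = f $ 2 \<and> b = - f $ 2 *s hz \<and>
        c = f $ 1 *s hz \<and> e = 0 \<and> d = 0"
        by (auto simp: h.B2_iff heis_cochain_eq_iff[OF h.char_pos] vec3_eq_iff axis_def
          z_dual_def)
    next
      assume "a $ 1 = f $ 1 \<and> a $ 2 = f $ 2 \<and> b = - f $ 2 *s hz \<and>
        c = f $ 1 *s hz \<and> e = 0 \<and> d = 0"
      thus "heis_cochain a b c d e f \<in> h.B2"
        unfolding h.B2_iff heis_cochain_eq_iff[OF h.char_pos]
        by (intro exI[of _ "- f"] exI[of _ "a $ 3 - f $ 3"])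
           (auto simp: vec3_eq_iff axis_def z_dual_def)
    qed
    have sum: "(\<Sum>i<length es. h.cochain_scale (k i) (es ! i)) =
        heis_cochain (k 0 *s hx + k 1 *s hy) 0 0 (k 3 *s hz) (k 2 *s hz) 0" for k
      by (simp add: es_def h.heis_cochain_scale heis_cochain_add heis_cochain_eq_iff[OF h.char_pos]
        vec3_eq_iff eval_nat_numeral)
    have "set es \<subseteq> h.Z2"
      by (simp add: es_def Z2 axis_def)
    moreover have "\<forall>i<length es. k i = 0"
      if "(\<Sum>i<length es. h.cochain_scale (k i) (es ! i)) \<in> h.B2" for k
      using that unfolding sum B2
      by (simp add: es_def All_less_Suc vec3_eq_iff axis_def eval_nat_numeral)
    moreover have "\<exists>k. v - (\<Sum>i<length es. h.cochain_scale (k i) (es ! i)) \<in> h.B2"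
      if v: "v \<in> h.Z2" for v
    proof -
      obtain a b c d e f where "v = heis_cochain a b c d e f"
        using v by (rule h.Z2_cases)
      thus ?thesis
        using v unfolding sum
        by (intro exI[of _ "(!) [a $ 1 - f $ 1, a $ 2 - f $ 2, e $ 3, d $ 3]"])
           (auto simp: heis_cochain_diff Z2 B2 vec3_eq_iff axis_def eq_neg_iff_add_eq_0)
    qed
    ultimately show ?thesis
      using h.heis_H2_basis[of es]
      by (simp add: Let_def es_def h.heis_class_alt h.heis_class_semilin)
  qed
qed

end
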